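(* Let $n_1,n_2\ge 0$ be integers, let $\mathcal X=\{x_j\}_{j=1}^m\subset\mathbb C$ be a set of $m\ge n_1+n_2+2$ distinct points, and let $f:\mathcal X\to\mathbb C$ with $f\notin\mathscr R_{(n_1,n_2)}$ (i.e. $f$ does not agree on $\mathcal X$ with any element of $\mathscr R_{(n_1,n_2)}$). Let $\hat\xi=\hat p/\hat q\in\mathscr R_{(n_1,n_2)}$ be irreducible and a local minimax approximant to $f$ on $\mathcal X$, with defect $\upsilon(\hat p,\hat q)$, and put $n=n_1+n_2-\upsilon(\hat p,\hat q)$. Then: (1) $\displaystyle \max_{x\in\mathcal E(\hat\xi)}\mathrm{Re}\left(\overline{(f(x)-\hat\xi(x))\hat q(x)}\,\frac{g(x)}{\hat q(x)}\right)\ge 0$ for all $g\in\mathbb P_n$; (2) there exist $r$ extreme points $z_1,\dots,z_r\in\mathcal E(\hat\xi)$ with $n+2\le r\le 2n+3$, and positive numbers $\omega_1,\dots,\omega_r$ with $\sum_{j=1}^r\omega_j=1$, such that $$\sum_{j=1}^r\omega_j\,\overline{(f(z_j)-\hat\xi(z_j))\hat q(z_j)}\,\frac{g(z_j)}{\hat q(z_j)}=0\qquad\text{for all } g\in\mathbb P_n;$$ (3) for every $(s,t)\in\mathbb S$, $$\min_{(a,b)\in\mathbb P_{n_1}\times\mathbb P_{n_2}}\ \max_{x\in\mathcal E(\hat\xi)}\bigl(\rho(x)+\alpha(x)\bigr)\ge 0,$$ where $\mathbb S$, $\rho=\rho_{(s,t)}$ and $\alpha=\alpha_{(a,b)}$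 are as defined in the context.
   Context: $\mathbb P_k$ is the space of complex polynomials of degree at most $k$. $\mathscr R_{(n_1,n_2)}=\{p/q: p\in\mathbb P_{n_1},\ 0\not\equiv q\in\mathbb P_{n_2}\}$; a rational function is identified with its irreducible representation, and its error on $\mathcal X$ is infinite if it has a pole in $\mathcal X$. For $\xi\in\mathscr R_{(n_1,n_2)}$, $\|f-\xi\|_{\infty,\mathcal X}=\max_{x\in\mathcal X}|f(x)-\xi(x)|$. $\hat\xi$ is a local minimax approximant to $f$ on $\mathcal X$ if $\|f-\hat\xi\|_{\infty,\mathcal X}<\infty$ and there is $\varepsilon>0$ with $\|f-\xi\|_{\infty,\mathcal X}\ge\|f-\hat\xi\|_{\infty,\mathcal X}$ for all $\xi\in\mathscr R_{(n_1,n_2)}$ such that $\|\xi-\hat\xi\|_{\infty,\mathcal X}<\varepsilon$. In particular $\hat q$ has no zeros in $\mathcal X$. The defect of an irreducible $p/q\in\mathscr R_{(n_1,n_2)}$ is $\upsilon(p,q)=\min(n_1-\deg p,\ n_2-\deg q)$, with $\deg 0=-\infty$. Put $\hat e(x)=f(x)-\hat\xi(x)$. The set of extreme points is $\mathcal E(\hat\xi)=\{x\in\mathcal X: |\hat e(x)|=\|\hat e\|_{\infty,\mathcal X}\}$. For $(s,t)\in\mathbb P_{n_1}\times\mathbb P_{n_2}$ let $g=t\hat p-s\hat q\in\mathbb P_n$ and $$\kappa(x)=2\,\mathrm{Re}\left(\overline{\hat e(x)\hat q(x)}\,g(x)/\hat q(x)\right),\qquad \rho(x)=|f(x)t(x)-s(x)|^2-|f(x)t(x)-\hat\xi(x)t(x)|^2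 .$$ For $(a,b)\in\mathbb P_{n_1}\times\mathbb P_{n_2}$ let $c=b\hat p-a\hat q\in\mathbb P_n$ and $$\alpha(x)=2\,\mathrm{Re}\left(\overline{\hat e(x)\hat q(x)}\,c(x)/\hat q(x)\right).$$ Finally $\mathbb S=\{(s,t)\in\mathbb P_{n_1}\times\mathbb P_{n_2}:\ \kappa(x)=0\ \text{for all } x\in\mathcal E(\hat\xi)\}$. *)

theory Defs
  imports
    "HOL-Analysis.Analysis"
    "HOL-Computational_Algebra.Computational_Algebra"
    "HOL-Computational_Algebra.Field_as_Ring"
begin

definition polys_upto :: "nat \<Rightarrow> complex poly set" where
  "polys_upto k = {p. degree p \<le> k}"

definition ratfuns :: "nat \<Rightarrow> nat \<Rightarrow> complex poly fract set" where
  "ratfuns n1 n2 = {Fract p q | p q. p \<in> polys_upto n1 \<and> q \<in> polys_upto n2 \<and> q \<noteq> 0}"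

(* quot_of_fract yields the irreducible representation (with monic denominator), so removable
   singularities of a particular quotient p/q are not poles. *)
definition has_pole :: "complex poly fract \<Rightarrow> complex \<Rightarrow> bool" where
  "has_pole \<xi> x \<longleftrightarrow> poly (snd (quot_of_fract \<xi>)) x = 0"

(* Meaningful only where \<xi> has no pole. *)
definition rat_eval :: "complex poly fract \<Rightarrow> complex \<Rightarrow> complex" where
  "rat_eval \<xi> x = poly (fst (quot_of_fract \<xi>)) x / poly (snd (quot_of_fract \<xi>)) x"

(* The error of \<xi> as an approximant to f on the finite nonempty set X. *)
definition err_norm :: "complex set \<Rightarrow> (complex \<Rightarrow> complex) \<Rightarrow> complex poly fract \<Rightarrow> ereal" where
  "err_norm X f \<xi> =
     (if \<exists>x\<in>X. has_pole \<xi> x then \<infinity> else ereal (MAX x\<in>X. cmod (f x - rat_eval \<xi> x)))"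

definition agrees_on :: "complex set \<Rightarrow> (complex \<Rightarrow> complex) \<Rightarrow> complex poly fract \<Rightarrow> bool" where
  "agrees_on X f \<xi> \<longleftrightarrow> (\<forall>x\<in>X. \<not> has_pole \<xi> x \<and> f x = rat_eval \<xi> x)"

(* The distance of \<xi> to \<xi>h on X is the error of \<xi> as an approximant to the values of \<xi>h, which
   has no pole in X because its own error is finite. *)
definition local_minimax ::
    "nat \<Rightarrow> nat \<Rightarrow> complex set \<Rightarrow> (complex \<Rightarrow> complex) \<Rightarrow> complex poly fract \<Rightarrow> bool" where
  "local_minimax n1 n2 X f \<xi>h \<longleftrightarrow>
     \<xi>h \<in> ratfuns n1 n2 \<and> err_norm X f \<xi>h < \<infinity> \<and>
     (\<exists>\<epsilon>::real. \<epsilon> > 0 \<and>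
        (\<forall>\<xi>\<in>ratfuns n1 n2. err_norm X (rat_eval \<xi>h) \<xi> < ereal \<epsilon> \<longrightarrow>
           err_norm X f \<xi> \<ge> err_norm X f \<xi>h))"

(* The case p = 0 reflects the convention deg 0 = -\<infinity>.  For p and q within the degree bounds
   the subtractions do not truncate. *)
definition defect :: "nat \<Rightarrow> nat \<Rightarrow> complex poly \<Rightarrow> complex poly \<Rightarrow> nat" where
  "defect n1 n2 p q =
     (if p = 0 then n2 - degree q else min (n1 - degree p) (n2 - degree q))"

definition extreme_points ::
    "complex set \<Rightarrow> (complex \<Rightarrow> complex) \<Rightarrow> complex poly fract \<Rightarrow> complex set" where
  "extreme_points X f \<xi> = {x \<in> X. ereal (cmod (f x - rat_eval \<xi> x)) = err_norm X f \<xi>}"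

(* In the remaining definitions (p, q) is the irreducible representation of the approximant. *)

definition kappa ::
    "(complex \<Rightarrow> complex) \<Rightarrow> complex poly \<Rightarrow> complex poly \<Rightarrow> complex poly \<Rightarrow> complex poly
       \<Rightarrow> complex \<Rightarrow> real" where
  "kappa f p q s t x =
     2 * Re (cnj ((f x - rat_eval (Fract p q) x) * poly q x) * (poly (t * p - s * q) x / poly q x))"

definition rho ::
    "(complex \<Rightarrow> complex) \<Rightarrow> complex poly \<Rightarrow> complex poly \<Rightarrow> complex poly \<Rightarrow> complex poly
       \<Rightarrow> complex \<Rightarrow> real" where
  "rho f p q s t x =
     (cmod (f x * poly t x - poly s x))\<^sup>2
       - (cmod (f x * poly t x - rat_eval (Fract p q) x * poly t x))\<^sup>2"

definition alpha ::
    "(complex \<Rightarrow> complex) \<Rightarrow> complex poly \<Rightarrow> complex poly \<Rightarrow> complex poly \<Rightarrow> complex poly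
       \<Rightarrow> complex \<Rightarrow> real" where
  "alpha f p q a b x =
     2 * Re (cnj ((f x - rat_eval (Fract p q) x) * poly q x) * (poly (b * p - a * q) x / poly q x))"

definition first_order_kernel ::
    "nat \<Rightarrow> nat \<Rightarrow> complex set \<Rightarrow> (complex \<Rightarrow> complex) \<Rightarrow> complex poly \<Rightarrow> complex poly
       \<Rightarrow> (complex poly \<times> complex poly) set" where
  "first_order_kernel n1 n2 X f p q =
     {(s, t). s \<in> polys_upto n1 \<and> t \<in> polys_upto n2 \<and>
        (\<forall>x\<in>extreme_points X f (Fract p q). kappa f p q s t x = 0)}"

end

theory Submission
  imports Defs
begin

text \<open>
  Perturb the approximant to $(p + \epsilon s + \epsilon^2 a)/(q + \epsilon t + \epsilon^2 b)$.
  At an extreme point, the squared error times the squared modulus of the new denominator changes by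
  $\epsilon\kappa + \epsilon^2(\rho + \alpha) + O(\epsilon^3)$. If $\kappa$ vanishes and
  $\rho + \alpha$ is negative on all extreme points, a small $\epsilon > 0$ thus lowers the maximal
  error, contradicting local optimality. The first-order condition (1) is the case $s = t = 0$,
  because every $g$ of degree at most $n$ is of the form $bp - aq$ (Bezout with degree control).
  The weights in (2) then come from Farkas' lemma and Caratheodory's theorem; fewer than
  $n + 2$ nodes are impossible because $g$ can vanish at all of them but one. The minimum in (3) is
  attained because it is the value of a bounded linear program.
\<close>

section \<open>Linear inequalities over spaces of functions\<close>

definition fun_subspace :: "('e \<Rightarrow> real) set \<Rightarrow> bool" where
  "fun_subspace L \<longleftrightarrow> (\<lambda>_. 0) \<in> L \<and> (\<forall>u\<in>L. \<forall>v\<in>L. \<forall>c. (\<lambda>x. u x + c * v x) \<in> L)"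

lemma fun_subspace_zero: "fun_subspace L \<Longrightarrow> (\<lambda>_. 0) \<in> L"
  by (simp add: fun_subspace_def)

lemma fun_subspace_combine:
  "fun_subspace L \<Longrightarrow> u \<in> L \<Longrightarrow> v \<in> L \<Longrightarrow> (\<lambda>x. u x + c * v x) \<in> L"
  by (simp add: fun_subspace_def)

text \<open>
  A family of linear functionals on a real vector space is encoded by the subspace of all its value
  vectors, so that no dimension has to appear in a type.
\<close>

lemma farkas_coordinate:
  fixes L :: "('e \<Rightarrow> real) set"
  assumes "finite E" and "fun_subspace L"
    and "\<And>y. y \<in> L \<Longrightarrow> \<forall>x\<in>E. y x \<le> 0 \<Longrightarrow> y e \<le> 0"
  shows "\<exists>w. (\<forall>x\<in>E. w x \<ge> 0) \<and> (\<forall>y\<in>L. y e = (\<Sum>x\<in>E. w x * y x))"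
  using assms
proof (induction E arbitrary: L rule: finite_induct)
  case empty
  have "y e = 0" if "y \<in> L" for y
  proof -
    \<comment> \<open>This is the negative of \<open>y\<close>. With no constraint left, the
      hypothesis bounds \<open>y e\<close> from both sides.\<close>
    have "(\<lambda>x. y x + (-2) * y x) \<in> L"
      using fun_subspace_combine[OF empty(1) that that] .
    from empty(2)[OF this] empty(2)[OF that] show ?thesis by simp
  qed
  then show ?case by simp
next
  case (insert z E)
  show ?case
  \<comment> \<open>If the constraints on \<open>E\<close> alone already force
    \<open>y e \<le> 0\<close>, the point \<open>z\<close> gets weight 0. Otherwise a violating
    \<open>y0\<close> must have \<open>y0 z > 0\<close>, and \<open>z\<close> can be eliminated with
    it.\<close>
  proof (cases "\<forall>y\<in>L. (\<forall>x\<in>E. y x \<le> 0) \<longrightarrow> y e \<le> 0")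
    case True
    then obtain w where w: "\<forall>x\<in>E. w x \<ge> 0" "\<forall>y\<in>L. y e = (\<Sum>x\<in>E. w x * y x)"
      using insert.IH[OF insert.prems(1)] by blast
    have "(\<Sum>x\<in>E. (w(z:=0)) x * y x) = (\<Sum>x\<in>E. w x * y x)" for y
      using insert.hyps by (intro sum.cong) auto
    with w insert.hyps show ?thesis
      by (intro exI[of _ "w(z:=0)"]) auto
  next
    case False
    then obtain y0 where y0: "y0 \<in> L" "\<forall>x\<in>E. y0 x \<le> 0" "y0 e > 0"
      by (auto simp: not_le)
    have z: "y0 z > 0"
      using insert.prems(2)[OF y0(1)] y0 by force
    \<comment> \<open>Projecting along \<open>y0\<close> onto \<open>L'\<close> eliminates the constraint \<open>z\<close>.\<close>
    define L' where "L' = {y\<in>L. y z = 0}"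
    have "fun_subspace L'"
      using insert.prems(1) by (auto simp: fun_subspace_def L'_def)
    moreover have "y e \<le> 0" if "y \<in> L'" "\<forall>x\<in>E. y x \<le> 0" for y
      using insert.prems(2)[of y] that by (auto simp: L'_def)
    ultimately obtain w where w: "\<forall>x\<in>E. w x \<ge> 0" "\<forall>y\<in>L'. y e = (\<Sum>x\<in>E. w x * y x)"
      using insert.IH by blast
    \<comment> \<open>The weight of \<open>z\<close> is dictated by the desired identity at
      \<open>y0\<close> itself. It is nonnegative because \<open>y0 e > 0\<close> while
      \<open>y0\<close> is nonpositive on \<open>E\<close>.\<close>
    define d where "d = (y0 e - (\<Sum>x\<in>E. w x * y0 x)) / y0 z"
    have "(\<Sum>x\<in>E. w x * y0 x) \<le> 0"
      using w y0 by (intro sum_nonpos) (auto simp: mult_nonneg_nonpos)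
    then have d: "d \<ge> 0" using z y0 by (simp add: d_def)
    have main: "y e = d * y z + (\<Sum>x\<in>E. w x * y x)" if "y \<in> L" for y
    proof -
      define c where "c = - (y z / y0 z)"
      have "(\<lambda>x. y x + c * y0 x) \<in> L'"
        using fun_subspace_combine[OF insert.prems(1) that y0(1), of c] z by (simp add: L'_def c_def)
      then have "y e + c * y0 e = (\<Sum>x\<in>E. w x * (y x + c * y0 x))"
        using w(2) by (auto dest: bspec)
      also have "\<dots> = (\<Sum>x\<in>E. w x * y x) + c * (\<Sum>x\<in>E. w x * y0 x)"
        by (simp add: algebra_simps sum.distrib sum_distrib_left)
      finally have "y e = (\<Sum>x\<in>E. w x * y x) - c * (y0 e - (\<Sum>x\<in>E. w x * y0 x))"
        by (simp add: algebra_simps)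
      then show ?thesis by (simp add: c_def d_def)
    qed
    have "(\<Sum>x\<in>E. (w(z:=d)) x * y x) = (\<Sum>x\<in>E. w x * y x)" for y
      using insert.hyps by (intro sum.cong) auto
    with w d main insert.hyps show ?thesis
      by (intro exI[of _ "w(z:=d)"]) auto
  qed
qed

text \<open>This is the inhomogeneous Farkas alternative, reduced to
  \<open>farkas_coordinate\<close>: a homogenized solution with \<tau> > 0 could be rescaled by
  1/\<tau> to a solution of the infeasible system.\<close>

lemma farkas_affine:
  fixes L :: "('e \<Rightarrow> real) set"
  assumes "finite E" and L: "fun_subspace L"
    and infeasible: "\<And>y. y \<in> L \<Longrightarrow> \<exists>x\<in>E. y x > c x"
  shows "\<exists>w. (\<forall>x\<in>E. w x \<ge> 0) \<and> (\<forall>y\<in>L. (\<Sum>x\<in>E. w x * y x) = 0) \<and> (\<Sum>x\<in>E. w x * c x) < 0"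
proof -
  \<comment> \<open>Homogenize: \<open>\<tau>\<close> scales the right-hand side, and its sign is the extra coordinate \<open>None\<close>.\<close>
  define H where "H y \<tau> = case_option \<tau> (\<lambda>x. y x - \<tau> * c x)" for y and \<tau> :: real
  define K where "K = {H y \<tau> | y \<tau>. y \<in> L}"
  have comb: "(\<lambda>x. H u s x + k * H v t x) = H (\<lambda>x. u x + k * v x) (s + k * t)" for u v s t k
    by (rule ext) (auto simp: H_def algebra_simps split: option.splits)
  have "(\<lambda>_. 0) = H (\<lambda>_. 0) 0"
    by (rule ext) (auto simp: H_def split: option.splits)
  then have "(\<lambda>_. 0) \<in> K"
    using fun_subspace_zero[OF L] unfolding K_def by blast
  moreover have "(\<lambda>x. g x + k * h x) \<in> K" if gh: "g \<in> K" "h \<in> K" for g h k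
  proof -
    obtain u s v t where "u \<in> L" "v \<in> L" "g = H u s" "h = H v t"
      using gh unfolding K_def by blast
    then show ?thesis
      using comb fun_subspace_combine[OF L] unfolding K_def by blast
  qed
  ultimately have K: "fun_subspace K"
    by (simp add: fun_subspace_def)
  have "h None \<le> 0" if h: "h \<in> K" "\<forall>x\<in>Some ` E. h x \<le> 0" for h
  proof (rule ccontr)
    assume "\<not> h None \<le> 0"
    obtain y \<tau> where y: "y \<in> L" "h = H y \<tau>" using h(1) unfolding K_def by blast
    then have \<tau>: "\<tau> > 0" using \<open>\<not> h None \<le> 0\<close> by (simp add: H_def)
    have "(\<lambda>x. 0 + (1 / \<tau>) * y x) \<in> L"
      using fun_subspace_combine[OF L fun_subspace_zero[OF L] y(1)] .
    then obtain x where x: "x \<in> E" "c x < 0 + (1 / \<tau>) * y x" using infeasible by blast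
    then have "\<tau> * c x < y x" using \<tau> by (simp add: field_simps)
    moreover have "y x - \<tau> * c x \<le> 0" using that x y by (auto simp: H_def)
    ultimately show False by simp
  qed
  then obtain w where w: "\<forall>x\<in>Some ` E. w x \<ge> 0"
      "\<forall>h\<in>K. h None = (\<Sum>x\<in>Some ` E. w x * h x)"
    using farkas_coordinate[OF finite_imageI[OF assms(1)] K] by blast
  have eq: "\<tau> = (\<Sum>x\<in>E. w (Some x) * (y x - \<tau> * c x))" if "y \<in> L" for y \<tau>
  proof -
    have "H y \<tau> None = (\<Sum>x\<in>Some ` E. w x * H y \<tau> x)"
      using w(2) that by (auto simp: K_def)
    then show ?thesis by (simp add: H_def sum.reindex)
  qed
  \<comment> \<open>The choice y = 0, \<tau> = 1 fixes the sign of the weighted right-hand side;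
    \<tau> = 0 then gives the orthogonality to \<open>L\<close>.\<close>
  have "1 = - (\<Sum>x\<in>E. w (Some x) * c x)"
    using eq[OF fun_subspace_zero[OF L], of 1] by (simp add: sum_negf)
  with w(1) eq[where \<tau> = 0] show ?thesis
    by (intro exI[of _ "\<lambda>x. w (Some x)"]) auto
qed

text \<open>No \<open>y\<close> in \<open>L\<close> is at most -1 on all of \<open>E\<close>, so
  \<open>farkas_affine\<close> applies with the constant right-hand side -1. Its strict inequality
  says that the total weight is positive, which permits normalization.\<close>

lemma gordan:
  fixes L :: "('e \<Rightarrow> real) set"
  assumes "finite E" and "fun_subspace L" and "\<And>y. y \<in> L \<Longrightarrow> \<exists>x\<in>E. y x \<ge> 0"
  shows "\<exists>w. (\<forall>x\<in>E. w x \<ge> 0) \<and> (\<Sum>x\<in>E. w x) = 1 \<and> (\<forall>y\<in>L. (\<Sum>x\<in>E. w x * y x) = 0)"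
proof -
  have "\<exists>x\<in>E. y x > -1" if "y \<in> L" for y
    using assms(3)[OF that] by force
  then obtain w where w: "\<forall>x\<in>E. w x \<ge> 0" "\<forall>y\<in>L. (\<Sum>x\<in>E. w x * y x) = 0"
      "(\<Sum>x\<in>E. w x * (-1)) < 0"
    using farkas_affine[OF assms(1,2), of "\<lambda>_. -1"] by blast
  define W where "W = (\<Sum>x\<in>E. w x)"
  have W: "W > 0" using w(3) by (simp add: W_def sum_negf)
  have "(\<Sum>x\<in>E. w x / W * y x) = 0" if "y \<in> L" for y
  proof -
    have "(\<Sum>x\<in>E. w x / W * y x) = (\<Sum>x\<in>E. w x * y x) / W"
      by (simp add: sum_divide_distrib)
    then show ?thesis using w(2) that by simp
  qed
  moreover have "(\<Sum>x\<in>E. w x / W) = 1"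
    using W by (simp add: sum_divide_distrib[symmetric] W_def[symmetric])
  ultimately show ?thesis
    using w(1) W by (intro exI[of _ "\<lambda>x. w x / W"]) auto
qed

text \<open>Linear programming duality: if the infimum \<open>v\<close> were not attained, the
  system \<open>y x \<le> v - c x\<close> would be infeasible. The Farkas weights would then give a
  lower bound for all maxima that exceeds \<open>v\<close>.\<close>

lemma minimax_attained:
  fixes L :: "('e \<Rightarrow> real) set" and c :: "'e \<Rightarrow> real"
  assumes "finite E" "E \<noteq> {}" and L: "fun_subspace L"
    and lower: "\<And>y. y \<in> L \<Longrightarrow> b \<le> (MAX x\<in>E. c x + y x)"
  shows "\<exists>y\<in>L. \<forall>u\<in>L. (MAX x\<in>E. c x + y x) \<le> (MAX x\<in>E. c x + u x)"
proof -
  define F where "F y = (MAX x\<in>E. c x + y x)" for y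
  define v where "v = Inf (F ` L)"
  have bdd: "bdd_below (F ` L)" using lower by (auto simp: F_def intro: bdd_belowI[of _ b])
  have ne: "F ` L \<noteq> {}" using fun_subspace_zero[OF L] by auto
  have "\<exists>y\<in>L. \<forall>x\<in>E. y x \<le> v - c x"
  proof (rule ccontr)
    assume "\<not> ?thesis"
    then have "\<exists>x\<in>E. y x > v - c x" if "y \<in> L" for y using that by force
    then obtain w where w: "\<forall>x\<in>E. w x \<ge> 0" "\<forall>y\<in>L. (\<Sum>x\<in>E. w x * y x) = 0"
        "(\<Sum>x\<in>E. w x * (v - c x)) < 0"
      using farkas_affine[OF assms(1) L, of "\<lambda>x. v - c x"] by blast
    define W where "W = (\<Sum>x\<in>E. w x)"
    have gap: "W * v < (\<Sum>x\<in>E. w x * c x)"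
      using w(3) by (simp add: W_def algebra_simps sum_subtractf sum_distrib_left)
    \<comment> \<open>The weights annihilate \<open>L\<close>, so adding \<open>y\<close> to
      \<open>c\<close> leaves the weighted sum unchanged, and each summand is bounded through the
      maximum.\<close>
    have below: "(\<Sum>x\<in>E. w x * c x) \<le> W * F y" if "y \<in> L" for y
    proof -
      have "(\<Sum>x\<in>E. w x * c x) = (\<Sum>x\<in>E. w x * (c x + y x))"
        using w(2) that by (simp add: distrib_left sum.distrib)
      also have "\<dots> \<le> (\<Sum>x\<in>E. w x * F y)"
        using w(1) assms(1) by (intro sum_mono mult_left_mono) (auto simp: F_def)
      finally show ?thesis by (simp add: W_def sum_distrib_right)
    qed
    have "W \<ge> 0" using w(1) by (simp add: W_def sum_nonneg)
    \<comment> \<open>For \<open>W = 0\<close>, \<open>gap\<close> would make the weighted sum of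
      \<open>c\<close> positive, while \<open>below\<close> at the zero function would make it
      nonpositive.\<close>
    moreover have "W \<noteq> 0"
      using gap below[OF fun_subspace_zero[OF L]] by auto
    ultimately have W: "W > 0" by simp
    have "(\<Sum>x\<in>E. w x * c x) / W \<le> v"
      unfolding v_def using ne below W by (intro cInf_greatest) (auto simp: field_simps)
    with gap W show False by (simp add: field_simps)
  qed
  then obtain y where y: "y \<in> L" "\<forall>x\<in>E. y x \<le> v - c x" by blast
  have "F y \<le> v" unfolding F_def using assms y by (subst Max_le_iff) (auto simp: algebra_simps)
  moreover have "v \<le> F u" if "u \<in> L" for u
    unfolding v_def using bdd that by (intro cInf_lower) auto
  ultimately show ?thesis using y(1) unfolding F_def by force
qed

section \<open>Reduction of convex weights to few nodes\<close>

lemma homogeneous_system_nontrivial_solution: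
  fixes A :: "'k \<Rightarrow> 's \<Rightarrow> real"
  assumes "finite K" "finite S" "card K < card S"
  shows "\<exists>\<mu>. (\<exists>s\<in>S. \<mu> s \<noteq> 0) \<and> (\<forall>k\<in>K. (\<Sum>s\<in>S. A k s * \<mu> s) = 0)"
  using assms
proof (induction K arbitrary: S A rule: finite_induct)
  case empty
  then obtain s where "s \<in> S" by fastforce
  then show ?case by (intro exI[of _ "\<lambda>_. 1"]) auto
next
  case (insert k K)
  show ?case
  proof (cases "\<forall>s\<in>S. A k s = 0")
    case True
    have "card K < card S" using insert by simp
    with insert.IH[OF insert.prems(1)] True show ?thesis by fastforce
  next
    case False
    then obtain t where t: "t \<in> S" "A k t \<noteq> 0" by blast
    \<comment> \<open>Gaussian elimination: \<open>B\<close> is the system after the unknown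
      \<open>t\<close> has been eliminated by means of equation \<open>k\<close>. It has one
      equation and one unknown less.\<close>
    define B where "B j s = A j s - A j t * A k s / A k t" for j s
    have "card K < card (S - {t})" using insert t by simp
    then obtain \<mu> where \<mu>: "\<exists>s\<in>S - {t}. \<mu> s \<noteq> 0"
        "\<forall>j\<in>K. (\<Sum>s\<in>S - {t}. B j s * \<mu> s) = 0"
      using insert.IH[of "S - {t}" B] insert.prems by blast
    \<comment> \<open>Back substitution: \<open>c\<close> is the value of the unknown
      \<open>t\<close> that satisfies equation \<open>k\<close>.\<close>
    define c where "c = - (\<Sum>s\<in>S - {t}. A k s * \<mu> s) / A k t"
    have split: "(\<Sum>s\<in>S. A j s * (\<mu>(t := c)) s) = A j t * c + (\<Sum>s\<in>S - {t}. A j s * \<mu> s)" for j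
      by (subst sum.remove[OF insert.prems(1) t(1)]) (auto intro: sum.cong)
    have "(\<Sum>s\<in>S - {t}. B j s * \<mu> s) = A j t * c + (\<Sum>s\<in>S - {t}. A j s * \<mu> s)" for j
    proof -
      have "(\<Sum>s\<in>S - {t}. B j s * \<mu> s)
          = (\<Sum>s\<in>S - {t}. A j s * \<mu> s - A j t / A k t * (A k s * \<mu> s))"
        by (intro sum.cong) (auto simp: B_def algebra_simps)
      also have "\<dots> = (\<Sum>s\<in>S - {t}. A j s * \<mu> s) - A j t / A k t * (\<Sum>s\<in>S - {t}. A k s * \<mu> s)"
        by (simp only: sum_subtractf sum_distrib_left)
      finally show ?thesis by (simp add: c_def)
    qed
    then have "\<forall>j\<in>K. (\<Sum>s\<in>S. A j s * (\<mu>(t := c)) s) = 0"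
      using \<mu>(2) split by simp
    moreover have "(\<Sum>s\<in>S. A k s * (\<mu>(t := c)) s) = 0"
      using split[of k] t by (simp add: c_def)
    moreover have "\<exists>s\<in>S. (\<mu>(t := c)) s \<noteq> 0" using \<mu>(1) by auto
    ultimately show ?thesis by (intro exI[of _ "\<mu>(t := c)"]) auto
  qed
qed

text \<open>Take a support of least cardinality among all admissible nonnegative weights. If it had
  more than \<open>card K + 1\<close> points, a nonzero direction preserving all equations and the
  total weight would exist, and moving along it would bring some weight to zero.\<close>

lemma caratheodory_weights:
  fixes w :: "'s \<Rightarrow> real" and A :: "'k \<Rightarrow> 's \<Rightarrow> real"
  assumes "finite E" "finite K" "\<forall>x\<in>E. w x \<ge> 0" "(\<Sum>x\<in>E. w x) = 1"
    and "\<forall>k\<in>K. (\<Sum>x\<in>E. A k x * w x) = 0"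
  shows "\<exists>S u. S \<subseteq> E \<and> card S \<le> card K + 1 \<and> (\<forall>x\<in>S. u x > 0) \<and> (\<Sum>x\<in>S. u x) = 1
           \<and> (\<forall>k\<in>K. (\<Sum>x\<in>S. A k x * u x) = 0)"
proof -
  define P where "P S u \<longleftrightarrow> S \<subseteq> E \<and> (\<forall>x\<in>S. u x \<ge> 0) \<and> (\<Sum>x\<in>S. u x) = 1
           \<and> (\<forall>k\<in>K. (\<Sum>x\<in>S. A k x * u x) = 0)" for S and u :: "'s \<Rightarrow> real"
  have "\<exists>u. P E u" using assms by (auto simp: P_def)
  then obtain S where S: "\<exists>u. P S u" and minS: "\<And>T. \<exists>u. P T u \<Longrightarrow> card S \<le> card T"
    using ex_has_least_nat[of "\<lambda>S. \<exists>u. P S u" E card] by blast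
  obtain u where u: "P S u" using S by blast
  have finS: "finite S" using u assms(1) by (auto simp: P_def dest: finite_subset)
  have drop: False if "P S v" "x \<in> S" "v x = 0" for v x
  proof -
    have "P (S - {x}) v"
      using that finS by (auto simp: P_def sum.remove[OF finS that(2)])
    then have "card S \<le> card (S - {x})" using minS by blast
    with finS that(2) show False by (metis card_Diff1_less not_le)
  qed
  have pos: "\<forall>x\<in>S. u x > 0"
    using drop[OF u] u unfolding P_def by (metis less_eq_real_def)
  have "card S \<le> card K + 1"
  proof (rule ccontr)
    assume big: "\<not> ?thesis"
    \<comment> \<open>The index \<open>None\<close> adds a row of ones, so that a kernel vector
      \<mu> also preserves the total weight.\<close>
    define B where "B = case_option (\<lambda>_. 1) A"
    have "card (insert None (Some ` K)) = card K + 1"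
      using assms(2) by (subst card_insert_disjoint) (auto simp: card_image)
    then obtain \<mu> where nz: "\<exists>s\<in>S. \<mu> s \<noteq> 0"
        and eqs: "\<forall>k\<in>insert None (Some ` K). (\<Sum>s\<in>S. B k s * \<mu> s) = 0"
      using homogeneous_system_nontrivial_solution[of "insert None (Some ` K)" S B] finS assms(2) big
      by auto
    have m0: "(\<Sum>s\<in>S. \<mu> s) = 0" and mA: "\<forall>k\<in>K. (\<Sum>s\<in>S. A k s * \<mu> s) = 0"
      using eqs by (auto simp: B_def)
    \<comment> \<open>A nonzero \<mu> with sum 0 has a positive entry, so some weight decreases
      along the motion.\<close>
    define R where "R = {s\<in>S. \<mu> s > 0}"
    have "R \<noteq> {}"
    proof
      assume "R = {}"
      then have "\<forall>s\<in>S. - \<mu> s \<ge> 0" by (force simp: R_def)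
      moreover have "(\<Sum>s\<in>S. - \<mu> s) = 0" using m0 by (simp add: sum_negf)
      ultimately have "\<forall>s\<in>S. - \<mu> s = 0"
        using sum_nonneg_eq_0_iff[OF finS, of "\<lambda>s. - \<mu> s"] by blast
      with nz show False by simp
    qed
    moreover have "finite R" using finS by (simp add: R_def)
    ultimately obtain x where x: "x \<in> R" "\<And>y. y \<in> R \<Longrightarrow> u x / \<mu> x \<le> u y / \<mu> y"
      using arg_min_if_finite(1) arg_min_least[where f = "\<lambda>y. u y / \<mu> y"] by meson
    \<comment> \<open>Ratio test: \<theta> is the largest step that keeps all weights nonnegative,
      and the weight at the minimizing point \<open>x\<close> becomes exactly 0.\<close>
    define \<theta> where "\<theta> = u x / \<mu> x"
    define v where "v y = u y - \<theta> * \<mu> y" for y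
    have xS: "x \<in> S" "\<mu> x > 0" using x by (auto simp: R_def)
    have \<theta>: "\<theta> \<ge> 0" using pos xS by (auto simp: \<theta>_def less_imp_le)
    have "v y \<ge> 0" if "y \<in> S" for y
    proof (cases "\<mu> y > 0")
      case True
      then have "\<theta> \<le> u y / \<mu> y" using x(2)[of y] that by (simp add: R_def \<theta>_def)
      with True show ?thesis by (simp add: v_def field_simps)
    next
      case False
      then have "\<theta> * \<mu> y \<le> 0" using \<theta> by (simp add: mult_nonneg_nonpos)
      moreover have "u y > 0" using pos that by blast
      ultimately show ?thesis by (simp add: v_def)
    qed
    moreover have "(\<Sum>y\<in>S. v y) = 1"
      using u m0 by (simp add: v_def P_def sum_subtractf sum_distrib_left[symmetric])
    moreover have "(\<Sum>y\<in>S. A k y * v y) = 0" if "k \<in> K" for k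
    proof -
      have "(\<Sum>y\<in>S. A k y * v y) = (\<Sum>y\<in>S. A k y * u y) - \<theta> * (\<Sum>y\<in>S. A k y * \<mu> y)"
        by (simp add: v_def algebra_simps sum_subtractf sum_distrib_left)
      then show ?thesis using u mA that by (simp add: P_def)
    qed
    ultimately have "P S v" using u by (simp add: P_def)
    moreover have "v x = 0" using xS by (simp add: v_def \<theta>_def)
    ultimately show False using drop xS by blast
  qed
  then show ?thesis using u pos unfolding P_def by blast
qed

section \<open>Rational functions and perturbations\<close>

lemma coprime_no_common_root:
  fixes a b :: "complex poly"
  assumes "coprime a b" "poly a x = 0"
  shows "poly b x \<noteq> 0"
proof
  assume "poly b x = 0"
  then have "[:-x, 1:] dvd a" "[:-x, 1:] dvd b"
    using assms(2) by (simp_all add: poly_eq_0_iff_dvd)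
  then have "[:-x, 1:] dvd 1"
    using assms(1) by (rule coprime_common_divisor[rotated])
  then have "poly (1 :: complex poly) x = 0" by (simp only: poly_eq_0_iff_dvd)
  then show False by simp
qed

lemma quot_of_fract_Fract_cross:
  fixes p q :: "complex poly"
  assumes "q \<noteq> 0"
  shows "fst (quot_of_fract (Fract p q)) * q = p * snd (quot_of_fract (Fract p q))"
proof -
  have "Fract (fst (quot_of_fract (Fract p q))) (snd (quot_of_fract (Fract p q))) = Fract p q"
    by (rule Fract_quot_of_fract)
  then show ?thesis using assms by (subst (asm) eq_fract) auto
qed

text \<open>The representation may be reducible, as can happen for perturbed quotients. If the
  reduced denominator vanished at \<open>x\<close>, cross multiplication would make the reduced
  numerator vanish there too, against coprimality.\<close>

lemma
  fixes p q :: "complex poly"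
  assumes "poly q x \<noteq> 0"
  shows has_no_pole_Fract: "\<not> has_pole (Fract p q) x"
    and rat_eval_Fract: "rat_eval (Fract p q) x = poly p x / poly q x"
proof -
  define a b where "a = fst (quot_of_fract (Fract p q))" and "b = snd (quot_of_fract (Fract p q))"
  have "q \<noteq> 0" using assms by auto
  from arg_cong[OF quot_of_fract_Fract_cross[OF this, of p], of "\<lambda>r. poly r x"]
  have cross: "poly a x * poly q x = poly p x * poly b x" by (simp add: a_def b_def)
  have "coprime a b" unfolding a_def b_def by (rule coprime_quot_of_fract)
  then have b: "poly b x \<noteq> 0"
    using coprime_no_common_root[of a b x] cross assms by auto
  then show "\<not> has_pole (Fract p q) x" by (simp add: has_pole_def b_def)
  show "rat_eval (Fract p q) x = poly p x / poly q x"
    using b assms cross unfolding rat_eval_def a_def[symmetric] b_def[symmetric]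
    by (simp add: field_simps)
qed

text \<open>Coprimality excludes removable singularities: at a zero of \<open>q\<close>, cross
  multiplication and \<open>poly p x \<noteq> 0\<close> make the reduced denominator vanish as
  well.\<close>

lemma denominator_nonzero:
  fixes p q :: "complex poly"
  assumes "coprime p q" "q \<noteq> 0" "\<not> has_pole (Fract p q) x"
  shows "poly q x \<noteq> 0"
proof
  assume q: "poly q x = 0"
  from arg_cong[OF quot_of_fract_Fract_cross[OF assms(2), of p], of "\<lambda>r. poly r x"] q
  have "poly p x * poly (snd (quot_of_fract (Fract p q))) x = 0" by simp
  moreover have "poly p x \<noteq> 0" using coprime_no_common_root[of q p x] assms(1) q
    by (simp add: coprime_commute)
  ultimately show False using assms(3) by (simp add: has_pole_def)
qed

section \<open>Degree bounds and Bezout representations\<close>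

lemma polys_upto_add_smult:
  "p \<in> polys_upto k \<Longrightarrow> r \<in> polys_upto k \<Longrightarrow> p + smult c r \<in> polys_upto k"
  unfolding polys_upto_def by (auto intro!: degree_add_le order.trans[OF degree_smult_le])

text \<open>A Bezout multiplier of \<open>p\<close> may be reduced modulo \<open>q\<close>, which
  bounds the degree of \<open>b\<close>. The degree of \<open>a\<close> is then read off from the
  product \<open>q * a = b * p - g\<close>.\<close>

lemma bezout_degree_bounded:
  fixes p q g :: "complex poly"
  assumes "coprime p q" "q \<noteq> 0" "degree p \<le> k" "degree g \<le> k + degree q"
  shows "\<exists>a b. degree a \<le> k \<and> degree b \<le> degree q \<and> b * p - a * q = g"
proof -
  obtain u v where uv: "u * p + v * q = 1"
    using bezout_coefficients_fst_snd[of p q] assms(1) by (metis coprime_imp_gcd_eq_1)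
  define b where "b = (u * g) mod q"
  have b: "b = 0 \<or> degree b < degree q"
    unfolding b_def using degree_mod_less[OF assms(2)] by blast
  have "b * p - g = (u * g - q * ((u * g) div q)) * p - (u * p + v * q) * g"
    by (simp add: b_def uv minus_mult_div_eq_mod)
  also have "\<dots> = q * (- ((u * g) div q) * p - v * g)" by (simp add: algebra_simps)
  finally have "q dvd b * p - g" by (metis dvd_triv_left)
  then obtain a where a: "b * p - g = q * a" by (elim dvdE)
  have "degree (b * p - g) \<le> k + degree q"
  proof (rule degree_diff_le)
    show "degree (b * p) \<le> k + degree q"
      using b assms(3) degree_mult_le[of b p] by (cases "b = 0") auto
  qed (rule assms)
  then have "degree a \<le> k"
    using a assms(2) by (cases "a = 0") (auto simp: degree_mult_eq)
  moreover have "degree b \<le> degree q" using b by auto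
  moreover have "b * p - a * q = g" using a by (simp add: algebra_simps)
  ultimately show ?thesis by blast
qed

text \<open>The degree bound on \<open>g\<close> equals \<open>n1 + degree q\<close> or
  \<open>n2 + degree p\<close>, according to which slack attains the defect. The second case
  exchanges the roles of \<open>p\<close> and \<open>q\<close>; the convention for
  \<open>p = 0\<close> belongs to the first.\<close>

lemma polys_upto_eq_combination:
  assumes "coprime p q" "q \<noteq> 0" "p \<in> polys_upto n1" "q \<in> polys_upto n2"
    and "g \<in> polys_upto (n1 + n2 - defect n1 n2 p q)"
  shows "\<exists>a\<in>polys_upto n1. \<exists>b\<in>polys_upto n2. b * p - a * q = g"
proof (cases "p = 0 \<or> n2 - degree q \<le> n1 - degree p")
  case True
  then have "n1 + n2 - defect n1 n2 p q = n1 + degree q"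
    using assms(3,4) by (auto simp: defect_def polys_upto_def)
  then obtain a b where ab: "degree a \<le> n1" "degree b \<le> degree q" "b * p - a * q = g"
    using bezout_degree_bounded[of p q n1 g] assms by (auto simp: polys_upto_def)
  then have "a \<in> polys_upto n1" "b \<in> polys_upto n2"
    using assms(4) by (simp_all add: polys_upto_def)
  with ab(3) show ?thesis by blast
next
  case False
  then have "n1 + n2 - defect n1 n2 p q = n2 + degree p"
    using assms(3,4) by (auto simp: defect_def polys_upto_def)
  then obtain a b where "degree a \<le> n2" "degree b \<le> degree p" "b * q - a * p = g"
    using bezout_degree_bounded[of q p n2 g] assms False
    by (auto simp: polys_upto_def coprime_commute)
  then show ?thesis using assms(3)
    by (intro bexI[of _ "- b"] bexI[of _ "- a"]) (auto simp: polys_upto_def algebra_simps)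
qed

section \<open>Second-order expansion of the error under perturbation\<close>

lemma cmod_square_diff_expand:
  fixes u v w :: complex and \<epsilon> :: real
  shows "(cmod (u + \<epsilon> * v))\<^sup>2 - (cmod (u + \<epsilon> * w))\<^sup>2
           = \<epsilon> * (2 * Re (cnj u * (v - w))) + \<epsilon>\<^sup>2 * ((cmod v)\<^sup>2 - (cmod w)\<^sup>2)"
  unfolding cmod_power2 by (simp add: power2_eq_square algebra_simps)

text \<open>Both moduli expand around the same \<open>u = (F - P / Q) * Q\<close>, so the constant
  terms cancel. The cross term supplies \<kappa> at first order and \<alpha> at second order. The
  last bracket is \<rho> for the shifted pair (S + \<epsilon> A, T + \<epsilon> B), which absorbs
  all higher powers of \<epsilon> and keeps the identity exact.\<close>

lemma perturbed_error_expand: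
  fixes F P Q S T A B :: complex and \<epsilon> :: real
  assumes "Q \<noteq> 0"
  shows "(cmod (F * (Q + of_real \<epsilon> * T + (of_real \<epsilon>)\<^sup>2 * B)
               - (P + of_real \<epsilon> * S + (of_real \<epsilon>)\<^sup>2 * A)))\<^sup>2
           - (cmod ((F - P / Q) * (Q + of_real \<epsilon> * T + (of_real \<epsilon>)\<^sup>2 * B)))\<^sup>2
       = \<epsilon> * (2 * Re (cnj ((F - P / Q) * Q) * ((T * P - S * Q) / Q)))
         + \<epsilon>\<^sup>2 * (2 * Re (cnj ((F - P / Q) * Q) * ((B * P - A * Q) / Q))
             + ((cmod (F * (T + of_real \<epsilon> * B) - (S + of_real \<epsilon> * A)))\<^sup>2
                - (cmod (F * (T + of_real \<epsilon> * B) - P / Q * (T + of_real \<epsilon> * B)))\<^sup>2))"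
proof -
  define u v w where "u = (F - P / Q) * Q"
    and "v = F * (T + of_real \<epsilon> * B) - (S + of_real \<epsilon> * A)"
    and "w = F * (T + of_real \<epsilon> * B) - P / Q * (T + of_real \<epsilon> * B)"
  have 1: "F * (Q + of_real \<epsilon> * T + (of_real \<epsilon>)\<^sup>2 * B)
      - (P + of_real \<epsilon> * S + (of_real \<epsilon>)\<^sup>2 * A) = u + of_real \<epsilon> * v"
    using assms by (simp add: u_def v_def algebra_simps power2_eq_square)
  have 2: "(F - P / Q) * (Q + of_real \<epsilon> * T + (of_real \<epsilon>)\<^sup>2 * B) = u + of_real \<epsilon> * w"
    by (simp add: u_def w_def algebra_simps power2_eq_square)
  have 3: "v - w = (T * P - S * Q) / Q + of_real \<epsilon> * ((B * P - A * Q) / Q)"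
    using assms by (simp add: v_def w_def field_simps)
  have scale: "Re (cnj u * (of_real \<epsilon> * y)) = \<epsilon> * Re (cnj u * y)" for y :: complex
    by (simp add: algebra_simps)
  have "2 * Re (cnj u * (v - w)) = 2 * Re (cnj u * ((T * P - S * Q) / Q))
      + \<epsilon> * (2 * Re (cnj u * ((B * P - A * Q) / Q)))"
    unfolding 3 distrib_left plus_complex.sel scale by simp
  then show ?thesis
    unfolding 1 2 u_def[symmetric] v_def[symmetric] w_def[symmetric] cmod_square_diff_expand
    by (simp add: algebra_simps power2_eq_square)
qed

lemma err_norm_less_iff:
  assumes "finite X" "X \<noteq> {}"
  shows "err_norm X f \<xi> < ereal \<delta> \<longleftrightarrow>
           (\<forall>x\<in>X. \<not> has_pole \<xi> x \<and> cmod (f x - rat_eval \<xi> x) < \<delta>)"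
  using assms by (auto simp: err_norm_def)

text \<open>This contains the first-order condition as well, through s = t = 0. Only extreme points
  require the expansion: elsewhere the error lies strictly below the maximum and stays there by
  continuity. Finiteness of \<open>X\<close> lets one \<epsilon> serve all points.\<close>

lemma second_order_condition:
  fixes p q a b s t :: "complex poly"
  assumes X: "finite X" "X \<noteq> {}"
    and pq: "p \<in> polys_upto n1" "q \<in> polys_upto n2" "q \<noteq> 0" "coprime p q"
    and opt: "local_minimax n1 n2 X f (Fract p q)"
    and st: "(s, t) \<in> first_order_kernel n1 n2 X f p q"
    and ab: "a \<in> polys_upto n1" "b \<in> polys_upto n2"
  shows "\<exists>x\<in>extreme_points X f (Fract p q). rho f p q s t x + alpha f p q a b x \<ge> 0"
proof (rule ccontr)
  define \<xi> where "\<xi> = Fract p q"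
  define E where "E = extreme_points X f \<xi>"
  define e where "e x = f x - poly p x / poly q x" for x
  assume "\<not> ?thesis"
  then have neg: "rho f p q s t x + alpha f p q a b x < 0" if "x \<in> E" for x
    using that by (force simp: E_def \<xi>_def)
  have fin: "err_norm X f \<xi> < \<infinity>" using opt by (simp add: local_minimax_def \<xi>_def)
  then have nopole: "\<not> has_pole \<xi> x" if "x \<in> X" for x
    using that by (auto simp: err_norm_def split: if_splits)
  then have qX: "poly q x \<noteq> 0" if "x \<in> X" for x
    using denominator_nonzero[OF pq(4,3)] that by (simp add: \<xi>_def)
  have ev: "rat_eval \<xi> x = poly p x / poly q x" if "x \<in> X" for x
    unfolding \<xi>_def by (rule rat_eval_Fract[OF qX[OF that]])
  define M where "M = (MAX x\<in>X. cmod (f x - rat_eval \<xi> x))"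
  have err: "err_norm X f \<xi> = ereal M" using nopole by (auto simp: err_norm_def M_def)
  have EX: "E = {x\<in>X. cmod (e x) = M}"
    unfolding E_def extreme_points_def err using ev by (auto simp: e_def)
  have le: "cmod (e x) \<le> M" if "x \<in> X" for x
    using that X ev by (auto simp: M_def e_def intro!: Max_ge)
  obtain \<delta> :: real where \<delta>: "\<delta> > 0"
      and locmin: "\<And>\<eta>. \<eta> \<in> ratfuns n1 n2 \<Longrightarrow> err_norm X (rat_eval \<xi>) \<eta> < ereal \<delta>
                    \<Longrightarrow> err_norm X f \<eta> \<ge> ereal M"
    using opt err unfolding local_minimax_def \<xi>_def by metis
  define P where "P \<epsilon> = p + smult (of_real \<epsilon>) s + smult ((of_real \<epsilon>)\<^sup>2) a" for \<epsilon>
  define Q where "Q \<epsilon> = q + smult (of_real \<epsilon>) t + smult ((of_real \<epsilon>)\<^sup>2) b" for \<epsilon>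
  define r where "r x \<epsilon> = poly (P \<epsilon>) x / poly (Q \<epsilon>) x" for x \<epsilon>
  \<comment> \<open>This is the full factor of \<epsilon> squared in the expansion. It still depends
    on \<epsilon> and tends to \<rho> + \<alpha>.\<close>
  define d where "d x \<epsilon> = alpha f p q a b x
      + ((cmod (f x * (poly t x + of_real \<epsilon> * poly b x) - (poly s x + of_real \<epsilon> * poly a x)))\<^sup>2
        - (cmod (f x * (poly t x + of_real \<epsilon> * poly b x)
            - poly p x / poly q x * (poly t x + of_real \<epsilon> * poly b x)))\<^sup>2)" for x \<epsilon>
  have Q_lim: "((\<lambda>\<epsilon>. poly (Q \<epsilon>) x) \<longlongrightarrow> poly q x) (at_right 0)" for x
    unfolding Q_def by (auto intro!: tendsto_eq_intros)
  have P_lim: "((\<lambda>\<epsilon>. poly (P \<epsilon>) x) \<longlongrightarrow> poly p x) (at_right 0)" for x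
    unfolding P_def by (auto intro!: tendsto_eq_intros)
  have r_lim: "(r x \<longlongrightarrow> rat_eval \<xi> x) (at_right 0)" if "x \<in> X" for x
    unfolding r_def ev[OF that] by (intro tendsto_divide P_lim Q_lim qX that)
  have d_lim: "(d x \<longlongrightarrow> rho f p q s t x + alpha f p q a b x) (at_right 0)" if "x \<in> X" for x
  proof -
    have "(d x \<longlongrightarrow> alpha f p q a b x + ((cmod (f x * (poly t x + of_real 0 * poly b x)
            - (poly s x + of_real 0 * poly a x)))\<^sup>2
        - (cmod (f x * (poly t x + of_real 0 * poly b x)
            - poly p x / poly q x * (poly t x + of_real 0 * poly b x)))\<^sup>2)) (at_right 0)"
      unfolding d_def by (intro tendsto_intros)
    then show ?thesis
      using ev[OF that] by (simp add: rho_def \<xi>_def algebra_simps)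
  qed
  have "\<forall>\<^sub>F \<epsilon> in at_right 0. \<forall>x\<in>X. poly (Q \<epsilon>) x \<noteq> 0"
    using X(1) qX by (intro eventually_ball_finite) (auto intro: tendsto_imp_eventually_ne[OF Q_lim])
  moreover have "\<forall>\<^sub>F \<epsilon> in at_right 0. \<forall>x\<in>X. cmod (rat_eval \<xi> x - r x \<epsilon>) < \<delta>"
  proof (intro eventually_ball_finite X(1) ballI)
    fix x assume "x \<in> X"
    from tendstoD[OF r_lim[OF this] \<delta>]
    show "\<forall>\<^sub>F \<epsilon> in at_right 0. cmod (rat_eval \<xi> x - r x \<epsilon>) < \<delta>"
      by (simp add: dist_norm norm_minus_commute)
  qed
  moreover have "\<forall>\<^sub>F \<epsilon> in at_right 0. \<forall>x\<in>X - E. cmod (f x - r x \<epsilon>) < M"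
  proof (intro eventually_ball_finite ballI)
    fix x assume x: "x \<in> X - E"
    then have "cmod (f x - rat_eval \<xi> x) < M"
      using le[of x] by (auto simp: EX ev e_def)
    moreover have "((\<lambda>\<epsilon>. cmod (f x - r x \<epsilon>)) \<longlongrightarrow> cmod (f x - rat_eval \<xi> x)) (at_right 0)"
      using x by (intro tendsto_intros r_lim) auto
    ultimately show "\<forall>\<^sub>F \<epsilon> in at_right 0. cmod (f x - r x \<epsilon>) < M"
      by (rule order_tendstoD(2)[rotated])
  qed (use X in auto)
  moreover have "\<forall>\<^sub>F \<epsilon> in at_right 0. \<forall>x\<in>E. d x \<epsilon> < 0"
    using X(1) by (intro eventually_ball_finite ballI order_tendstoD(2)[OF d_lim] neg)
      (auto simp: EX)
  moreover have "\<forall>\<^sub>F \<epsilon>::real in at_right 0. \<epsilon> > 0"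
    by (rule eventually_at_right_less)
  ultimately have "\<forall>\<^sub>F \<epsilon> in at_right 0. \<epsilon> > 0 \<and> (\<forall>x\<in>X. poly (Q \<epsilon>) x \<noteq> 0)
      \<and> (\<forall>x\<in>X. cmod (rat_eval \<xi> x - r x \<epsilon>) < \<delta>) \<and> (\<forall>x\<in>X - E. cmod (f x - r x \<epsilon>) < M)
      \<and> (\<forall>x\<in>E. d x \<epsilon> < 0)"
    by eventually_elim blast
  from eventually_happens'[OF trivial_limit_at_right_real this]
  obtain \<epsilon> :: real where \<epsilon>: "\<epsilon> > 0" and all:
      "\<forall>x\<in>X. poly (Q \<epsilon>) x \<noteq> 0" "\<forall>x\<in>X. cmod (rat_eval \<xi> x - r x \<epsilon>) < \<delta>"
      "\<forall>x\<in>X - E. cmod (f x - r x \<epsilon>) < M" "\<forall>x\<in>E. d x \<epsilon> < 0"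
    by (elim exE conjE)
  note QX = bspec[OF all(1)] and near = bspec[OF all(2)] and off = bspec[OF all(3)]
    and on = bspec[OF all(4)]
  have less: "cmod (f x - r x \<epsilon>) < M" if x: "x \<in> X" for x
  proof (cases "x \<in> E")
    case True
    have "kappa f p q s t x = 0" using st True by (auto simp: first_order_kernel_def E_def \<xi>_def)
    then have k: "2 * Re (cnj ((f x - poly p x / poly q x) * poly q x)
        * ((poly t x * poly p x - poly s x * poly q x) / poly q x)) = 0"
      using ev[OF x] by (simp only: kappa_def \<xi>_def poly_diff poly_mult)
    have al: "alpha f p q a b x = 2 * Re (cnj ((f x - poly p x / poly q x) * poly q x)
        * ((poly b x * poly p x - poly a x * poly q x) / poly q x))"
      using ev[OF x] by (simp only: alpha_def \<xi>_def poly_diff poly_mult)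
    have PQ: "poly (P \<epsilon>) x = poly p x + of_real \<epsilon> * poly s x + (of_real \<epsilon>)\<^sup>2 * poly a x"
        "poly (Q \<epsilon>) x = poly q x + of_real \<epsilon> * poly t x + (of_real \<epsilon>)\<^sup>2 * poly b x"
      by (simp_all add: P_def Q_def)
    \<comment> \<open>As \<kappa> vanishes at \<open>x\<close>, only the second-order term remains,
      and its factor is negative.\<close>
    have "(cmod (f x * poly (Q \<epsilon>) x - poly (P \<epsilon>) x))\<^sup>2 - (cmod (e x * poly (Q \<epsilon>) x))\<^sup>2
        = \<epsilon>\<^sup>2 * d x \<epsilon>"
      by (simp only: PQ e_def d_def al perturbed_error_expand[OF qX[OF x]] k mult_zero_right add_0_left)
    also have "\<dots> < 0" using on[OF True] \<epsilon> by (simp add: mult_pos_neg)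
    finally have "cmod (f x * poly (Q \<epsilon>) x - poly (P \<epsilon>) x) < cmod (e x * poly (Q \<epsilon>) x)"
      by (simp add: power2_less_imp_less)
    \<comment> \<open>Both sides carry the nonzero factor \<open>poly (Q \<epsilon>) x\<close>;
      cancelling it compares the errors themselves.\<close>
    moreover have "f x * poly (Q \<epsilon>) x - poly (P \<epsilon>) x = (f x - r x \<epsilon>) * poly (Q \<epsilon>) x"
      using QX[OF x] by (simp add: r_def field_simps)
    ultimately have "cmod (f x - r x \<epsilon>) < cmod (e x)"
      using QX[OF x] by (simp add: norm_mult)
    then show ?thesis using True by (simp add: EX)
  qed (use off x in auto)
  define \<eta> where "\<eta> = Fract (P \<epsilon>) (Q \<epsilon>)"
  have "(s, t) \<in> polys_upto n1 \<times> polys_upto n2" using st by (simp add: first_order_kernel_def)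
  then have "P \<epsilon> \<in> polys_upto n1" "Q \<epsilon> \<in> polys_upto n2"
    using pq ab unfolding P_def Q_def by (auto intro!: polys_upto_add_smult)
  moreover have "Q \<epsilon> \<noteq> 0" using X QX by fastforce
  ultimately have rat: "\<eta> \<in> ratfuns n1 n2" unfolding \<eta>_def ratfuns_def by blast
  have eval: "\<not> has_pole \<eta> x" "rat_eval \<eta> x = r x \<epsilon>" if "x \<in> X" for x
    using has_no_pole_Fract[OF QX[OF that]] rat_eval_Fract[OF QX[OF that]]
    by (simp_all add: \<eta>_def r_def)
  have "err_norm X (rat_eval \<xi>) \<eta> < ereal \<delta>" "err_norm X f \<eta> < ereal M"
    using eval near less by (simp_all add: err_norm_less_iff[OF X])
  with locmin[OF rat] show False by simp
qed

section \<open>Optimality conditions\<close>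

lemma Re_of_real_mult: "Re (of_real c * z) = c * Re z"
  by simp

lemma fun_subspace_Re_poly:
  "fun_subspace {\<lambda>x. Re (h x * (poly g x / poly q x)) | g. g \<in> polys_upto n}" (is "fun_subspace ?L")
  unfolding fun_subspace_def
proof (intro conjI ballI allI)
  have "(0 :: complex poly) \<in> polys_upto n" by (simp add: polys_upto_def)
  moreover have "(\<lambda>_. 0) = (\<lambda>x. Re (h x * (poly 0 x / poly q x)))" by simp
  ultimately show "(\<lambda>_. 0) \<in> ?L" by blast
next
  fix u v and c :: real
  assume "u \<in> ?L" "v \<in> ?L"
  then obtain g g' where g: "g \<in> polys_upto n" "g' \<in> polys_upto n"
      "u = (\<lambda>x. Re (h x * (poly g x / poly q x)))" "v = (\<lambda>x. Re (h x * (poly g' x / poly q x)))"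
    by blast
  have "u x + c * v x = Re (h x * (poly (g + smult (of_real c) g') x / poly q x))" for x
  proof -
    have "h x * (poly (g + smult (of_real c) g') x / poly q x)
        = h x * (poly g x / poly q x) + of_real c * (h x * (poly g' x / poly q x))"
      by (simp add: add_divide_distrib distrib_left)
    then show ?thesis by (simp only: g plus_complex.sel Re_of_real_mult)
  qed
  then show "(\<lambda>x. u x + c * v x) \<in> ?L"
    using polys_upto_add_smult[OF g(1,2), of "of_real c"] by blast
qed

text \<open>\<open>gordan\<close> gives weights on all of \<open>E\<close> that balance the real
  parts. Testing with monomials turns this into 2n + 2 real equations, so the Caratheodory reduction
  leaves at most 2n + 3 nodes.\<close>

lemma balanced_weights:
  fixes h :: "complex \<Rightarrow> complex" and q :: "complex poly"
  assumes E: "finite E" and nz: "\<And>x. x \<in> E \<Longrightarrow> h x \<noteq> 0" "\<And>x. x \<in> E \<Longrightarrow> poly q x \<noteq> 0"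
    and nonneg: "\<And>g. g \<in> polys_upto n \<Longrightarrow> \<exists>x\<in>E. Re (h x * (poly g x / poly q x)) \<ge> 0"
  shows "\<exists>S u. S \<subseteq> E \<and> n + 2 \<le> card S \<and> card S \<le> 2 * n + 3 \<and> (\<forall>x\<in>S. u x > (0::real))
           \<and> (\<Sum>x\<in>S. u x) = 1
           \<and> (\<forall>g\<in>polys_upto n. (\<Sum>x\<in>S. of_real (u x) * h x * (poly g x / poly q x)) = 0)"
proof -
  define L where "L = {\<lambda>x. Re (h x * (poly g x / poly q x)) | g. g \<in> polys_upto n}"
  have "fun_subspace L" unfolding L_def by (rule fun_subspace_Re_poly)
  moreover have "\<exists>x\<in>E. y x \<ge> 0" if "y \<in> L" for y
    using that nonneg unfolding L_def by blast
  ultimately obtain w where w: "\<forall>x\<in>E. w x \<ge> 0" "(\<Sum>x\<in>E. w x) = 1"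
      and wL: "\<forall>y\<in>L. (\<Sum>x\<in>E. w x * y x) = 0"
    using gordan[OF E] by blast
  have wg: "(\<Sum>x\<in>E. w x * Re (h x * (poly g x / poly q x))) = 0" if "g \<in> polys_upto n" for g
  proof -
    have "(\<lambda>x. Re (h x * (poly g x / poly q x))) \<in> L" using that unfolding L_def by blast
    from bspec[OF wL this] show ?thesis .
  qed
  \<comment> \<open>One equation for each exponent up to \<open>n\<close> and each of real and
    imaginary part.\<close>
  define K where "K = {..n} \<times> (UNIV :: bool set)"
  define A where "A = (\<lambda>(k, re) x. (if re then Re else Im) (h x * (x ^ k / poly q x)))"
  have K: "finite K" "card K = 2 * n + 2" by (simp_all add: K_def card_cartesian_product)
  have "(\<Sum>x\<in>E. A (k, re) x * w x) = 0" if "k \<le> n" for k re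
  proof (cases re)
    case True
    have "monom 1 k \<in> polys_upto n" using that by (simp add: polys_upto_def degree_monom_eq)
    from wg[OF this] show ?thesis
      using True by (simp add: A_def poly_monom mult.commute)
  next
    case False
    \<comment> \<open>Multiplying the test polynomial by -i converts the real part into the
      imaginary part.\<close>
    have "monom (- \<i>) k \<in> polys_upto n" using that by (simp add: polys_upto_def degree_monom_eq)
    note wg[OF this]
    moreover have "Re (h x * (poly (monom (- \<i>) k) x / poly q x)) = Im (h x * (x ^ k / poly q x))" for x
    proof -
      have "h x * (poly (monom (- \<i>) k) x / poly q x) = - \<i> * (h x * (x ^ k / poly q x))"
        by (simp add: poly_monom)
      moreover have "Re (- \<i> * y) = Im y" for y by simp
      ultimately show ?thesis by (simp only:)
    qed
    ultimately show ?thesis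
      using False by (simp only: A_def mult.commute[of _ "w _"] if_False prod.case)
  qed
  then have "\<forall>k\<in>K. (\<Sum>x\<in>E. A k x * w x) = 0" by (auto simp: K_def)
  from caratheodory_weights[OF E K(1) w(1,2) this]
  obtain S u where S: "S \<subseteq> E" "card S \<le> 2 * n + 3" "\<forall>x\<in>S. u x > 0" "(\<Sum>x\<in>S. u x) = 1"
      and AS: "\<forall>k\<in>K. (\<Sum>x\<in>S. A k x * u x) = 0"
    using K(2) by auto
  have finS: "finite S" using S(1) E by (rule finite_subset)
  have powers: "(\<Sum>x\<in>S. of_real (u x) * h x * (x ^ k / poly q x)) = 0" if "k \<le> n" for k
  proof -
    have "(\<Sum>x\<in>S. of_real (u x) * (h x * (x ^ k / poly q x))) = 0"
    proof (rule complex_eqI)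
      have "(\<Sum>x\<in>S. A (k, True) x * u x) = 0" using AS that by (simp add: K_def)
      then show "Re (\<Sum>x\<in>S. of_real (u x) * (h x * (x ^ k / poly q x))) = Re 0"
        by (simp only: Re_sum A_def if_True prod.case Re_complex_of_real Im_complex_of_real
            times_complex.sel mult_zero_left diff_zero zero_complex.sel mult.commute[of "u _"])
      have "(\<Sum>x\<in>S. A (k, False) x * u x) = 0" using AS that by (simp add: K_def)
      then show "Im (\<Sum>x\<in>S. of_real (u x) * (h x * (x ^ k / poly q x))) = Im 0"
        by (simp only: Im_sum A_def if_False prod.case Re_complex_of_real Im_complex_of_real
            times_complex.sel(2)[of "of_real _"] mult_zero_left add_0_right zero_complex.sel
            mult.commute[of "u _"])
    qed
    then show ?thesis by (simp only: mult.assoc)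
  qed
  have balance: "(\<Sum>x\<in>S. of_real (u x) * h x * (poly g x / poly q x)) = 0"
    if g: "g \<in> polys_upto n" for g
  proof -
    have "poly g x = (\<Sum>k\<le>n. coeff g k * x ^ k)" for x
      unfolding poly_altdef using g
      by (intro sum.mono_neutral_left) (auto simp: polys_upto_def coeff_eq_0)
    then have "(\<Sum>x\<in>S. of_real (u x) * h x * (poly g x / poly q x))
        = (\<Sum>x\<in>S. \<Sum>k\<le>n. coeff g k * (of_real (u x) * h x * (x ^ k / poly q x)))"
      by (intro sum.cong refl) (simp add: sum_divide_distrib sum_distrib_left mult_ac)
    also have "\<dots> = (\<Sum>k\<le>n. coeff g k * (\<Sum>x\<in>S. of_real (u x) * h x * (x ^ k / poly q x)))"
      by (subst sum.swap) (simp only: sum_distrib_left)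
    finally show ?thesis using powers by simp
  qed
  have "n + 2 \<le> card S"
  proof (rule ccontr)
    assume "\<not> ?thesis"
    obtain x0 where x0: "x0 \<in> S" using S(4) by fastforce
    \<comment> \<open>With fewer than n + 2 nodes, \<open>g\<close> has degree at most
      \<open>n\<close> and vanishes at every node except \<open>x0\<close>. Balance would leave a
      single term, which is nonzero.\<close>
    define g where "g = (\<Prod>y\<in>S - {x0}. [:- y, 1:])"
    have "degree g \<le> (\<Sum>y\<in>S - {x0}. degree [:- y, 1:])"
      unfolding g_def using degree_prod_sum_le[of "S - {x0}" "\<lambda>y. [:- y, 1:]"] finS
      by (simp add: o_def)
    also have "\<dots> = card S - 1" using x0 finS by simp
    finally have "g \<in> polys_upto n" using \<open>\<not> n + 2 \<le> card S\<close> by (simp add: polys_upto_def)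
    then have "0 = (\<Sum>x\<in>S. of_real (u x) * h x * (poly g x / poly q x))"
      by (rule balance[symmetric])
    also have "\<dots> = of_real (u x0) * h x0 * (poly g x0 / poly q x0)
        + (\<Sum>x\<in>S - {x0}. of_real (u x) * h x * (poly g x / poly q x))"
      by (rule sum.remove[OF finS x0])
    also have "(\<Sum>x\<in>S - {x0}. of_real (u x) * h x * (poly g x / poly q x)) = 0"
      using finS by (intro sum.neutral) (auto simp: g_def poly_prod)
    finally have "of_real (u x0) * h x0 * (poly g x0 / poly q x0) = 0" by simp
    moreover have "poly g x0 \<noteq> 0" using finS by (auto simp: g_def poly_prod)
    moreover have "u x0 > 0" "h x0 \<noteq> 0" "poly q x0 \<noteq> 0" using x0 S nz by auto
    ultimately show False by simp
  qed
  then show ?thesis using S balance by blast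
qed

text \<open>\<alpha> depends real-linearly on (a, b), so \<open>minimax_attained\<close> applies to
  its value vectors.\<close>

lemma fun_subspace_alpha:
  "fun_subspace {alpha f p q a b | a b. a \<in> polys_upto n1 \<and> b \<in> polys_upto n2}" (is "fun_subspace ?L")
  unfolding fun_subspace_def
proof (intro conjI ballI allI)
  have "(\<lambda>_. 0) = alpha f p q 0 0" by (rule ext) (simp add: alpha_def)
  then show "(\<lambda>_. 0) \<in> ?L" by (force simp: polys_upto_def)
next
  fix u v and c :: real
  assume "u \<in> ?L" "v \<in> ?L"
  then obtain a b a' b' where ab: "a \<in> polys_upto n1" "b \<in> polys_upto n2" "u = alpha f p q a b"
      "a' \<in> polys_upto n1" "b' \<in> polys_upto n2" "v = alpha f p q a' b'"
    by blast
  have "u x + c * v x = alpha f p q (a + smult (of_real c) a') (b + smult (of_real c) b') x" for x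
  proof -
    have "k * (poly ((b + smult (of_real c) b') * p - (a + smult (of_real c) a') * q) x / d)
        = k * (poly (b * p - a * q) x / d) + of_real c * (k * (poly (b' * p - a' * q) x / d))" for k d
      by (simp add: add_divide_distrib diff_divide_distrib algebra_simps)
    then show ?thesis
      unfolding ab(3,6) alpha_def by (simp only: plus_complex.sel Re_of_real_mult)
        (simp only: distrib_left mult.left_commute)
  qed
  then show "(\<lambda>x. u x + c * v x) \<in> ?L"
    using polys_upto_add_smult ab by blast
qed

section \<open>Assembly of the three optimality conditions\<close>

theorem theorem2p2:
  fixes n1 n2 n :: nat and X E :: "complex set" and f :: "complex \<Rightarrow> complex"
    and p q :: "complex poly" and \<xi> :: "complex poly fract"
  assumes "finite X" and "card X \<ge> n1 + n2 + 2"
    and "\<not> (\<exists>\<eta>\<in>ratfuns n1 n2. agrees_on X f \<eta>)"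
    and "p \<in> polys_upto n1" and "q \<in> polys_upto n2" and "q \<noteq> 0" and "coprime p q"
    and "\<xi> = Fract p q" and "local_minimax n1 n2 X f \<xi>"
    and "n = n1 + n2 - defect n1 n2 p q"
    and "E = extreme_points X f \<xi>"
  shows
    "(\<forall>g\<in>polys_upto n.
        (MAX x\<in>E. Re (cnj ((f x - rat_eval \<xi> x) * poly q x) * (poly g x / poly q x))) \<ge> 0)
     \<and>
     (\<exists>(r::nat) (z :: nat \<Rightarrow> complex) (\<omega> :: nat \<Rightarrow> real).
        n + 2 \<le> r \<and> r \<le> 2 * n + 3 \<and>
        inj_on z {1..r} \<and> z ` {1..r} \<subseteq> E \<and>
        (\<forall>j\<in>{1..r}. \<omega> j > 0) \<and> (\<Sum>j=1..r. \<omega> j) = 1 \<and>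
        (\<forall>g\<in>polys_upto n.
           (\<Sum>j=1..r. of_real (\<omega> j) * cnj ((f (z j) - rat_eval \<xi> (z j)) * poly q (z j))
                        * (poly g (z j) / poly q (z j))) = 0))
     \<and>
     (\<forall>(s, t)\<in>first_order_kernel n1 n2 X f p q.
        \<exists>ab. is_arg_min (\<lambda>(a, b). MAX x\<in>E. rho f p q s t x + alpha f p q a b x)
                        (\<lambda>(a, b). a \<in> polys_upto n1 \<and> b \<in> polys_upto n2) ab
           \<and> (case ab of (a, b) \<Rightarrow> (MAX x\<in>E. rho f p q s t x + alpha f p q a b x) \<ge> 0))"
proof -
  define h where "h x = cnj ((f x - rat_eval \<xi> x) * poly q x)" for x
  have X: "finite X" "X \<noteq> {}" using assms(1,2) by auto
  have E: "finite E" "E \<subseteq> X" using X assms(11) by (auto simp: extreme_points_def)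
  have max_ge: "(MAX x\<in>E. k x) \<ge> 0" if "\<exists>x\<in>E. k x \<ge> 0" for k :: "complex \<Rightarrow> real"
    using that E(1) by (subst Max_ge_iff) auto
  note soc = second_order_condition[OF X assms(4-7) assms(9)[unfolded assms(8)],
      folded assms(8), folded assms(11)]
  \<comment> \<open>At s = t = 0 both \<kappa> and \<rho> vanish, so \<open>soc\<close> becomes a
    statement about \<alpha> alone.\<close>
  have kernel0: "(0, 0) \<in> first_order_kernel n1 n2 X f p q"
    by (simp add: first_order_kernel_def kappa_def polys_upto_def)
  have ex1: "\<exists>x\<in>E. Re (h x * (poly g x / poly q x)) \<ge> 0" if g: "g \<in> polys_upto n" for g
  proof -
    obtain a b where ab: "a \<in> polys_upto n1" "b \<in> polys_upto n2" "b * p - a * q = g"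
      using polys_upto_eq_combination[OF assms(7,6,4,5)] g assms(10) by blast
    obtain x where x: "x \<in> E" "rho f p q 0 0 x + alpha f p q a b x \<ge> 0"
      using soc[OF kernel0 ab(1,2)] by blast
    have "alpha f p q a b x = 2 * Re (h x * (poly g x / poly q x))"
      by (simp only: alpha_def h_def ab(3) assms(8))
    moreover have "rho f p q 0 0 x = 0" by (simp add: rho_def)
    ultimately show ?thesis using x by (intro bexI[of _ x]) auto
  qed
  have part1: "(MAX x\<in>E. Re (h x * (poly g x / poly q x))) \<ge> 0" if "g \<in> polys_upto n" for g
    using ex1[OF that] by (rule max_ge)
  have fin: "err_norm X f \<xi> < \<infinity>" using assms(9) by (simp add: local_minimax_def)
  then have nopole: "\<not> has_pole \<xi> x" if "x \<in> X" for x
    using that by (auto simp: err_norm_def split: if_splits)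
  then have qX: "poly q x \<noteq> 0" if "x \<in> X" for x
    using denominator_nonzero[OF assms(7,6)] that assms(8) by blast
  \<comment> \<open>A zero of \<open>h\<close> at an extreme point would make the maximal error 0,
    so the approximant would interpolate \<open>f\<close> on \<open>X\<close>, which is
    excluded.\<close>
  have hE: "h x \<noteq> 0" if x: "x \<in> E" for x
  proof
    assume "h x = 0"
    then have "f x - rat_eval \<xi> x = 0" using qX x E by (auto simp: h_def)
    then have "err_norm X f \<xi> = ereal 0" using x assms(11) by (simp add: extreme_points_def)
    then have "err_norm X f \<xi> < ereal \<delta>" if "\<delta> > 0" for \<delta> using that by simp
    then have "\<forall>y\<in>X. cmod (f y - rat_eval \<xi> y) < \<delta>" if "\<delta> > 0" for \<delta>
      using that by (simp add: err_norm_less_iff[OF X])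
    then have "f y = rat_eval \<xi> y" if "y \<in> X" for y
      using that by (metis less_irrefl right_minus_eq zero_less_norm_iff)
    then have "agrees_on X f \<xi>" using nopole by (simp add: agrees_on_def)
    then show False using assms(3,9) by (auto simp: local_minimax_def)
  qed
  obtain S u where S: "S \<subseteq> E" "n + 2 \<le> card S" "card S \<le> 2 * n + 3" "\<forall>x\<in>S. u x > (0::real)"
      "(\<Sum>x\<in>S. u x) = 1"
      "\<forall>g\<in>polys_upto n. (\<Sum>x\<in>S. of_real (u x) * h x * (poly g x / poly q x)) = 0"
    using balanced_weights[where h = h and q = q and n = n, OF E(1) hE _ ex1] qX E(2) by blast
  have "finite S" using S(1) E(1) by (rule finite_subset)
  from ex_bij_betw_nat_finite_1[OF this]
  obtain z where z: "bij_betw z {1..card S} S" by blast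
  have part2: "\<exists>(r::nat) (z :: nat \<Rightarrow> complex) (\<omega> :: nat \<Rightarrow> real).
        n + 2 \<le> r \<and> r \<le> 2 * n + 3 \<and> inj_on z {1..r} \<and> z ` {1..r} \<subseteq> E \<and>
        (\<forall>j\<in>{1..r}. \<omega> j > 0) \<and> (\<Sum>j=1..r. \<omega> j) = 1 \<and>
        (\<forall>g\<in>polys_upto n.
           (\<Sum>j=1..r. of_real (\<omega> j) * h (z j) * (poly g (z j) / poly q (z j))) = 0)"
  proof (intro exI conjI ballI)
    show "inj_on z {1..card S}" "z ` {1..card S} \<subseteq> E"
      using z S(1) by (auto simp: bij_betw_def)
    show "u (z j) > 0" if "j \<in> {1..card S}" for j
      using that z S(4) by (auto simp: bij_betw_def)
    show "(\<Sum>j=1..card S. u (z j)) = 1"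
      using sum.reindex_bij_betw[OF z, of u] S(5) by simp
    show "(\<Sum>j=1..card S. of_real (u (z j)) * h (z j) * (poly g (z j) / poly q (z j))) = 0"
      if "g \<in> polys_upto n" for g
      using sum.reindex_bij_betw[OF z, of "\<lambda>x. of_real (u x) * h x * (poly g x / poly q x)"]
        S(6) that by simp
  qed (use S in auto)
  have "E \<noteq> {}" using S by auto
  have part3: "\<exists>ab. is_arg_min (\<lambda>(a, b). MAX x\<in>E. rho f p q s t x + alpha f p q a b x)
                        (\<lambda>(a, b). a \<in> polys_upto n1 \<and> b \<in> polys_upto n2) ab
           \<and> (case ab of (a, b) \<Rightarrow> (MAX x\<in>E. rho f p q s t x + alpha f p q a b x) \<ge> 0)"
    if st: "(s, t) \<in> first_order_kernel n1 n2 X f p q" for s t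
  proof -
    \<comment> \<open>The values of \<alpha> turn the minimization over pairs into one over a
      subspace; \<open>soc\<close> bounds it below by 0, hence the minimum exists.\<close>
    define L where "L = {alpha f p q a b | a b. a \<in> polys_upto n1 \<and> b \<in> polys_upto n2}"
    have lower: "0 \<le> (MAX x\<in>E. rho f p q s t x + y x)" if "y \<in> L" for y
      using that soc[OF st] by (auto simp: L_def intro!: max_ge)
    have "fun_subspace L" unfolding L_def by (rule fun_subspace_alpha)
    from minimax_attained[OF E(1) \<open>E \<noteq> {}\<close> this lower]
    obtain y where y: "y \<in> L"
        "\<forall>u\<in>L. (MAX x\<in>E. rho f p q s t x + y x) \<le> (MAX x\<in>E. rho f p q s t x + u x)"
      by (rule bexE)
    \<comment> \<open>Any pair representing the minimizing value vector is a minimizer.\<close>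
    obtain a b where ab: "a \<in> polys_upto n1" "b \<in> polys_upto n2" "y = alpha f p q a b"
      using y(1) unfolding L_def by blast
    have "(MAX x\<in>E. rho f p q s t x + alpha f p q a b x)
        \<le> (MAX x\<in>E. rho f p q s t x + alpha f p q a' b' x)"
      if "a' \<in> polys_upto n1" "b' \<in> polys_upto n2" for a' b'
    proof -
      have "alpha f p q a' b' \<in> L" using that unfolding L_def by blast
      from bspec[OF y(2) this] show ?thesis unfolding ab(3) .
    qed
    then show ?thesis
      using ab lower[OF y(1)]
      by (intro exI[of _ "(a, b)"]) (auto simp: is_arg_min_def not_less)
  qed
  show ?thesis
    using part1 part2 part3 unfolding h_def by blast
qed

end
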